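(* For all integers $L\ge 0$ and all integers $a$, $$T_1(L,a)=\sum_{k=0}^L D_{L,k}(a)\genfrac{[}{]}{0pt}{}{2k}{k-a}\qquad\text{and}\qquad \genfrac{[}{]}{0pt}{}{2L}{L-a}=\sum_{k=0}^L D'_{L,k}(a)\,T_1(k,a),$$ where $$D_{L,k}(a)=(-1)^{L-k}q^{\binom{L-k}{2}+\binom{a}{2}-\binom{L}{2}}\,\frac{1+q^a}{1+q^k}\genfrac{[}{]}{0pt}{}{L}{k},\qquad D'_{L,k}(a)=q^{\binom{k}{2}-\binom{a}{2}}\,\frac{1+q^L}{1+q^a}\genfrac{[}{]}{0pt}{}{L}{k}.$$
   Context: $q$ is an indeterminate; identities are identities of rational functions in $q$. $(q)_0=1$ and $(q)_n=\prod_{j=1}^n(1-q^j)$ for $n\ge1$. The $q$-binomial coefficient is $\genfrac{[}{]}{0pt}{}{n}{a}=\frac{(q)_n}{(q)_a(q)_{n-a}}$ if $0\le a\le n$, and $0$ otherwise. $\binom{x}{2}=x(x-1)/2$ for every integer $x$. The $q$-trinomial coefficient $T_n(L,a)$ is $$T_n(L,a)=\sum_{\substack{r=0\\ L-a-r\text{ even}}}^{L-|a|}\frac{q^{\frac12 r(r-n)}(q)_L}{(q)_{\frac{L-a-r}{2}}(q)_{\frac{L+a-r}{2}}(q)_r}$$ (an empty sum, i.e. $L<|a|$, being $0$). *)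

theory Defs
  imports
    Complex_Main
    "HOL-Computational_Algebra.Polynomial"
    "HOL-Computational_Algebra.Fraction_Field"
begin

definition qfac :: "'a::field \<Rightarrow> nat \<Rightarrow> 'a" where
  "qfac q n = (\<Prod>j=1..n. 1 - q ^ j)"

definition qbinom :: "'a::field \<Rightarrow> nat \<Rightarrow> int \<Rightarrow> 'a" where
  "qbinom q n a =
     (if 0 \<le> a \<and> a \<le> int n
      then qfac q n / (qfac q (nat a) * qfac q (nat (int n - a)))
      else 0)"

definition binom2 :: "int \<Rightarrow> int" where
  "binom2 x = x * (x - 1) div 2"

(* T_n(L,a).  The exponent r(r-n)/2 is an integer for every r exactly when n is odd, and then
   the division below is exact.  For even n, T_n(L,a) involves half-integral powers of q, is
   not a rational function of q, and is not represented by this definition.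
   In the index set, the bound r \<le> L - |a| makes (L-a-r)/2 and (L+a-r)/2 nonnegative and the
   parity condition makes both halvings exact. *)
definition qtrinom :: "'a::field \<Rightarrow> int \<Rightarrow> nat \<Rightarrow> int \<Rightarrow> 'a" where
  "qtrinom q n L a =
     (\<Sum>r \<in> {r::nat. int r \<le> int L - \<bar>a\<bar> \<and> even (int L - a - int r)}.
        q powi (int r * (int r - n) div 2) * qfac q L /
        (qfac q (nat ((int L - a - int r) div 2)) *
         qfac q (nat ((int L + a - int r) div 2)) *
         qfac q r))"

definition Dcoef :: "'a::field \<Rightarrow> nat \<Rightarrow> nat \<Rightarrow> int \<Rightarrow> 'a" where
  "Dcoef q L k a =
     (- 1) powi (int L - int k) *
     q powi (binom2 (int L - int k) + binom2 a - binom2 (int L)) *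
     ((1 + q powi a) / (1 + q ^ k)) * qbinom q L (int k)"

definition Dcoef' :: "'a::field \<Rightarrow> nat \<Rightarrow> nat \<Rightarrow> int \<Rightarrow> 'a" where
  "Dcoef' q L k a =
     q powi (binom2 (int k) - binom2 a) *
     ((1 + q ^ L) / (1 + q powi a)) * qbinom q L (int k)"

(* The indeterminate q of the field of rational functions over the rationals. *)
definition qvar :: "rat poly fract" where
  "qvar = Fract [:0, 1:] 1"

end

theory Submission
  imports Defs
begin

text \<open>
  Put \<open>u k = q^binom2 a (1 + q^a) / (1 + q^k) [2k, k-a]\<close> and \<open>v k = q^binom2 k T_1(k, a)\<close>.
  The second identity says \<open>u L = (\<Sum>k. [L, k] v k)\<close>, and the first one is its
  Gauss inversion. Expand \<open>T_1(k, a)\<close> and substitute \<open>i = (k - a - r) / 2\<close>,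
  \<open>s = r + i\<close>. The exponent becomes \<open>binom2 s + binom2 (s + a) + i (i + a)\<close>, so the
  \<open>q\<close>-Vandermonde sum over \<open>i\<close> gives
  \<open>\<Sum>s. q^(binom2 s + binom2 (s + a)) [L, s] [L, s + a]\<close>. This is again a
  \<open>q\<close>-Vandermonde sum up to a factor \<open>q^-s\<close>, which one application of the Pascal rule
  to \<open>[L, s]\<close> absorbs.
\<close>

section \<open>Triangular numbers, q-factorials and q-binomials\<close>

lemma binom2_double: "2 * binom2 x = x * (x - 1)"
  by (simp add: binom2_def)

lemma binom2_add: "binom2 (x + y) = binom2 x + binom2 y + x * y"
proof -
  have "2 * binom2 (x + y) = 2 * (binom2 x + binom2 y + x * y)"
    unfolding distrib_left binom2_double by (simp add: algebra_simps)
  then show ?thesis by simp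
qed

lemma binom2_0 [simp]: "binom2 0 = 0"
  by (simp add: binom2_def)

lemma binom2_1 [simp]: "binom2 1 = 0"
  by (simp add: binom2_def)

lemma qfac_0 [simp]: "qfac q 0 = 1"
  by (simp add: qfac_def)

lemma qfac_Suc: "qfac q (Suc n) = qfac q n * (1 - q ^ Suc n)"
  by (simp add: qfac_def)

lemma qbinom_eq_0: "k < 0 \<or> int n < k \<Longrightarrow> qbinom q n k = 0"
  by (auto simp: qbinom_def)

lemma qbinom_add: "qbinom q (j + m) (int j) = qfac q (j + m) / (qfac q j * qfac q m)"
  by (simp add: qbinom_def)

lemma qbinom_symmetric: "qbinom q n (int n - k) = qbinom q n k"
  by (auto simp: qbinom_def mult.commute)

text \<open>These two properties of the indeterminate suffice for the sum identities and the
  inversion: every \<open>qfac q n\<close> is invertible, and integer powers of \<open>q\<close> add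
  their exponents. The characteristic stays free, so \<open>1 + q ^ 0\<close> may vanish
  here.\<close>

locale non_root_of_unity =
  fixes q :: "'a::field"
  assumes q_nonzero [simp]: "q \<noteq> 0"
    and power_neq_1: "0 < n \<Longrightarrow> q ^ n \<noteq> 1"
begin

lemma qfac_nonzero [simp]: "qfac q n \<noteq> 0"
  using power_neq_1 by (force simp: qfac_def)

lemma qbinom_0 [simp]: "qbinom q n 0 = 1"
  by (simp add: qbinom_def)

lemma qbinom_self [simp]: "qbinom q n (int n) = 1"
  by (simp add: qbinom_def)

lemma powi_merge: "q powi x * q powi y = q powi (x + y)"
  by (simp add: power_int_add)

lemma one_plus_power_int_nonzero:
  assumes "k \<noteq> 0"
  shows "1 + q powi k \<noteq> 0"
proof
  assume "1 + q powi k = 0"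
  then have "q powi k = -1" by (simp add: add_eq_0_iff)
  \<comment> \<open>Squaring turns -1 into 1; the sign of the exponent is then removed to reach a
    positive natural exponent.\<close>
  then have "q powi (2 * k) = 1"
    by (simp add: power_int_mult mult.commute[of 2])
  moreover from this have "q powi (- (2 * k)) = 1"
    by (simp add: power_int_minus)
  ultimately have "q powi (2 * \<bar>k\<bar>) = 1"
    by (cases "k \<ge> 0") simp_all
  then have "q ^ nat (2 * \<bar>k\<bar>) = 1"
    by (simp add: power_int_def)
  then show False
    using power_neq_1[of "nat (2 * \<bar>k\<bar>)"] assms by simp
qed

section \<open>Pascal rules and the q-Vandermonde sum\<close>

lemma qbinom_pascal: "qbinom q (Suc n) k = qbinom q n (k - 1) + q powi k * qbinom q n k"
proof -
  consider "k < 0 \<or> k > int n + 1" | "k = 0" | "k = int (Suc n)"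
    | "1 \<le> k" "k \<le> int n" by linarith
  then show ?thesis
  proof cases
    case 1
    then show ?thesis by (auto simp: qbinom_eq_0)
  next
    case 2
    then show ?thesis by (simp add: qbinom_eq_0)
  next
    case 3
    show ?thesis unfolding 3 qbinom_self by (simp add: qbinom_eq_0)
  next
    case 4
    define j where "j = nat (k - 1)"
    define m where "m = nat (int n - k)"
    have k: "k = int (Suc j)" and n: "n = Suc j + m"
      using 4 by (auto simp: j_def m_def)
    have e1: "qbinom q (Suc n) k = qfac q n * (1 - q ^ Suc n) / (qfac q (Suc j) * qfac q (Suc m))"
      using qbinom_add[of q "Suc j" "Suc m"] by (simp add: k n qfac_Suc)
    have e2: "qbinom q n (k - 1) = qfac q n / (qfac q j * qfac q (Suc m))"
      using qbinom_add[of q j "Suc m"] by (simp add: k n)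
    have e3: "qbinom q n k = qfac q n / (qfac q (Suc j) * qfac q m)"
      using qbinom_add[of q "Suc j" m] by (simp add: k n)
    have nz: "1 - q ^ Suc j \<noteq> 0" "1 - q ^ Suc m \<noteq> 0"
      using power_neq_1[of "Suc j"] power_neq_1[of "Suc m"] by auto
    \<comment> \<open>The first summand cancels the last factor of \<open>qfac q (Suc j)\<close>,
      the second that of \<open>qfac q (Suc m)\<close>; this produces the two terms on the right of
      the rule.\<close>
    have split: "1 - q ^ Suc n = (1 - q ^ Suc j) + q ^ Suc j * (1 - q ^ Suc m)"
      by (simp add: n algebra_simps power_add)
    have pk: "q powi k = q ^ Suc j" by (simp only: k power_int_of_nat)
    show ?thesis
      unfolding e1 e2 e3 pk qfac_Suc split
      using nz by (simp add: divide_simps del: power_Suc) (simp add: algebra_simps)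
  qed
qed

lemma qbinom_pascal':
  "qbinom q (Suc n) k = qbinom q n k + q powi (int n + 1 - k) * qbinom q n (k - 1)"
proof -
  have "qbinom q (Suc n) k = qbinom q (Suc n) (int (Suc n) - k)"
    by (rule qbinom_symmetric[symmetric])
  also have "\<dots> = qbinom q n (int n - k)
      + q powi (int n + 1 - k) * qbinom q n (int n - (k - 1))"
    by (subst qbinom_pascal) (simp add: algebra_simps)
  finally show ?thesis
    unfolding qbinom_symmetric .
qed

text \<open>Induction on \<open>n\<close> with \<open>t\<close> arbitrary:
  \<open>qbinom_pascal'\<close> splits the last factor into the cases \<open>t\<close> and
  \<open>t - 1\<close>, and \<open>qbinom_pascal\<close> reassembles the two resulting
  values.\<close>

lemma q_vandermonde:
  "(\<Sum>i=0..m. q powi (int i * (int i + t)) * qbinom q m (int i) * qbinom q n (int i + t))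
     = qbinom q (m + n) (int n - t)"
proof (induction n arbitrary: t)
  case 0
  have *: "qbinom q 0 x = (if x = 0 then 1 else 0)" for x
    by (simp add: qbinom_def)
  show ?case
  proof (cases "0 \<le> - t \<and> - t \<le> int m")
    case True
    define j where "j = nat (- t)"
    have t: "t = - int j" and j: "j \<le> m" using True by (auto simp: j_def)
    \<comment> \<open>Only \<open>i = -t\<close> survives, and there the exponent
      \<open>i * (i + t)\<close> is 0.\<close>
    have "(\<Sum>i=0..m. q powi (int i * (int i + t)) * qbinom q m (int i) * qbinom q 0 (int i + t))
        = (\<Sum>i=0..m. if i = j then qbinom q m (int j) else 0)"
      by (intro sum.cong refl) (auto simp: t *)
    then show ?thesis using j by (simp add: t)
  next
    case False
    then have "qbinom q m (- t) = 0" by (auto simp: qbinom_eq_0)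
    moreover have "(\<Sum>i=0..m. q powi (int i * (int i + t)) * qbinom q m (int i) * qbinom q 0 (int i + t)) = 0"
      using False by (intro sum.neutral) (auto simp: *)
    ultimately show ?thesis by simp
  qed
next
  case (Suc n)
  have "(\<Sum>i=0..m. q powi (int i * (int i + t)) * qbinom q m (int i) * qbinom q (Suc n) (int i + t))
      = (\<Sum>i=0..m. q powi (int i * (int i + t)) * qbinom q m (int i) * qbinom q n (int i + t)
         + q powi (int n + 1 - t) *
           (q powi (int i * (int i + (t - 1))) * qbinom q m (int i) * qbinom q n (int i + (t - 1))))"
  proof (intro sum.cong refl)
    fix i
    \<comment> \<open>The Pascal weight turns the exponent into the one for \<open>t - 1\<close>, up
      to a factor free of \<open>i\<close>.\<close>
    have "q powi (int i * (int i + t)) * q powi (int n + 1 - (int i + t))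
        = q powi (int n + 1 - t) * q powi (int i * (int i + (t - 1)))"
      unfolding powi_merge by (simp add: algebra_simps)
    then show "q powi (int i * (int i + t)) * qbinom q m (int i) * qbinom q (Suc n) (int i + t)
      = q powi (int i * (int i + t)) * qbinom q m (int i) * qbinom q n (int i + t)
         + q powi (int n + 1 - t) *
           (q powi (int i * (int i + (t - 1))) * qbinom q m (int i) * qbinom q n (int i + (t - 1)))"
      unfolding qbinom_pascal' by (simp add: algebra_simps)
  qed
  also have "\<dots> = qbinom q (m + n) (int n - t)
      + q powi (int n + 1 - t) * qbinom q (m + n) (int n + 1 - t)"
    by (simp only: sum.distrib sum_distrib_left[symmetric] Suc) (simp add: algebra_simps)
  also have "\<dots> = qbinom q (m + Suc n) (int (Suc n) - t)"
    by (simp add: qbinom_pascal algebra_simps)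
  finally show ?case .
qed

section \<open>From q-trinomials to products of two q-binomials\<close>

lemma sum_qtrinom_eq:
  "(\<Sum>k=0..L. qbinom q L (int k) * q powi binom2 (int k) * qtrinom q 1 k a)
    = (\<Sum>s=0..L. q powi (binom2 (int s) + binom2 (int s + a)) * qbinom q L (int s) * qbinom q L (int s + a))"
    (is "?lhs = ?rhs")
proof -
  define R where "R k = {r::nat. int r \<le> int k - \<bar>a\<bar> \<and> even (int k - a - int r)}" for k :: nat
  have finR: "finite (R k)" for k
    by (rule finite_subset[of _ "{..k}"]) (auto simp: R_def)
  define f where "f = (\<lambda>(k, r). qbinom q L (int k) * q powi binom2 (int k) *
     (q powi binom2 (int r) * qfac q k /
        (qfac q (nat ((int k - a - int r) div 2)) *
         qfac q (nat ((int k + a - int r) div 2)) * qfac q r)))"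
  \<comment> \<open>Restricting \<open>i\<close> to the range where the last q-binomial in
    \<open>g\<close> is not zero by default makes the change of variables a bijection; the missing
    \<open>i\<close> are restored afterwards as zero terms.\<close>
  define B where "B s = {i \<in> {0..s}. 0 \<le> int i + a \<and> int i + a \<le> int (L - s)}" for s
  define g where "g = (\<lambda>(s, i). q powi (binom2 (int s) + binom2 (int s + a)) * qbinom q L (int s)
     * (q powi (int i * (int i + a)) * qbinom q s (int i) * qbinom q (L - s) (int i + a)))"
  have "?lhs = (\<Sum>k=0..L. \<Sum>r\<in>R k. f (k, r))"
    by (simp add: qtrinom_def R_def f_def sum_distrib_left binom2_def)
  also have "\<dots> = sum f (SIGMA k:{0..L}. R k)"
    using finR by (subst sum.Sigma) auto
  also have "\<dots> = sum g (SIGMA s:{0..L}. B s)"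
  proof -
    \<comment> \<open>With \<open>j = i + a\<close>, \<open>k = r + i + j\<close> and
      \<open>m = L - k\<close>, the q-factorials in both \<open>f\<close> and \<open>g\<close>
      reduce to \<open>(q)_L / ((q)_i (q)_j (q)_r (q)_m)\<close>. The left side groups these terms
      by \<open>r + i + j\<close>, the right side by \<open>s = r + i\<close>.\<close>
    define p where "p = (\<lambda>(k, r). (r + nat ((int k - a - int r) div 2), nat ((int k - a - int r) div 2)))"
    define p' where "p' = (\<lambda>(s, i). (nat (int s + int i + a), s - i))"
    have fwd: "p' (p x) = x \<and> p x \<in> (SIGMA s:{0..L}. B s) \<and> g (p x) = f x"
      if x: "x \<in> (SIGMA k:{0..L}. R k)" for x
    proof -
      obtain k r where x': "x = (k, r)" and kr: "k \<in> {0..L}" "r \<in> R k"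
        using x by blast
      define i where "i = nat ((int k - a - int r) div 2)"
      define j where "j = nat (int i + a)"
      from kr have "even (int k - a - int r)" "int r \<le> int k - \<bar>a\<bar>" "k \<le> L"
        by (auto simp: R_def)
      then have i: "int k - a - int r = 2 * int i" and "k \<le> L"
        by (auto simp: i_def)
      with \<open>int r \<le> int k - \<bar>a\<bar>\<close> have j: "a = int j - int i"
        by (simp add: j_def)
      with i have k: "k = r + i + j" by simp
      with \<open>k \<le> L\<close> have L: "r + i + j \<le> L" by simp
      define m where "m = L - (r + i + j)"
      have Lm: "L = r + i + j + m" using L by (simp add: m_def)
      have p: "p x = (r + i, i)" by (simp add: x' p_def i_def)
      have p'1: "p' (r + i, i) = (k, r)"
        by (simp add: p'_def j k)
      have p2: "(r + i, i) \<in> (SIGMA s:{0..L}. B s)"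
        using L by (auto simp: B_def j)
      \<comment> \<open>Here \<open>s + a = r + j\<close>, so this matches the exponents of
        \<open>g\<close> with those of \<open>f\<close>.\<close>
      have e: "binom2 (int r + int i) + binom2 (int r + int j) + int i * int j
          = binom2 (int k) + binom2 (int r)"
        by (simp add: k binom2_add algebra_simps)
      have hi: "(int k - a - int r) div 2 = int i" and hj: "(int k + a - int r) div 2 = int j"
        by (simp_all add: k j)
      have b1: "qbinom q L (int k) = qfac q L / (qfac q k * qfac q m)"
        using qbinom_add[of q k m] by (simp add: Lm k)
      have b2: "qbinom q L (int (r + i)) = qfac q L / (qfac q (r + i) * qfac q (j + m))"
        using qbinom_add[of q "r + i" "j + m"] by (simp add: Lm add.assoc)
      have b3: "qbinom q (r + i) (int i) = qfac q (r + i) / (qfac q i * qfac q r)"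
        using qbinom_add[of q i r] by (simp add: add.commute)
      have b4: "qbinom q (L - (r + i)) (int i + a) = qfac q (j + m) / (qfac q j * qfac q m)"
        using qbinom_add[of q j m] by (simp add: Lm j add.assoc)
      have "g (r + i, i) = q powi (binom2 (int k) + binom2 (int r)) *
          (qbinom q L (int (r + i)) * qbinom q (r + i) (int i) * qbinom q (L - (r + i)) (int i + a))"
        unfolding g_def e[symmetric] by (simp add: j power_int_add mult_ac)
      also have "\<dots> = f (k, r)"
        unfolding f_def prod.case hi hj b1 b2 b3 b4 by (simp add: power_int_add divide_simps)
      finally have "g (r + i, i) = f (k, r)" .
      with p'1 p2 show ?thesis by (simp only: p, simp add: x')
    qed
    have bwd: "p (p' x) = x \<and> p' x \<in> (SIGMA k:{0..L}. R k)"
      if x: "x \<in> (SIGMA s:{0..L}. B s)" for x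
    proof -
      obtain s i where x': "x = (s, i)" and "s \<in> {0..L}" "i \<in> B s"
        using x by blast
      then have "i \<le> s" "s \<le> L" and ia: "0 \<le> int i + a" "int i + a \<le> int (L - s)"
        by (auto simp: B_def)
      moreover define j where "j = nat (int i + a)"
      ultimately have a: "a = int j - int i" and j: "s + j \<le> L" by auto
      define r where "r = s - i"
      have s: "s = r + i" using \<open>i \<le> s\<close> by (simp add: r_def)
      have k: "nat (int s + int i + a) = r + i + j"
        by (simp add: a s)
      have p': "p' x = (r + i + j, r)" using k by (simp add: p'_def x' r_def)
      show ?thesis
        unfolding p' using j by (auto simp: p_def x' R_def s a)
    qed
    show ?thesis
      by (rule sum.reindex_bij_witness[where j = p and i = p']) (use fwd bwd in auto)
  qed
  also have "\<dots> = (\<Sum>s=0..L. \<Sum>i\<in>B s. g (s, i))"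
    by (subst sum.Sigma) (auto simp: B_def)
  also have "\<dots> = (\<Sum>s=0..L. \<Sum>i=0..s. g (s, i))"
  proof (rule sum.cong[OF refl], rule sum.mono_neutral_left)
    fix s
    have "qbinom q (L - s) (int i + a) = 0" if "i \<in> {0..s} - B s" for i
      using that by (intro qbinom_eq_0) (auto simp: B_def)
    then show "\<forall>i\<in>{0..s} - B s. g (s, i) = 0"
      by (simp add: g_def)
  qed (auto simp: B_def)
  also have "\<dots> = ?rhs"
  proof (intro sum.cong refl)
    fix s assume "s \<in> {0..L}"
    then have L: "L = s + (L - s)" by simp
    \<comment> \<open>q-Vandermonde with rows \<open>s\<close> and \<open>L - s\<close> and shift
      \<open>a\<close>; symmetry then turns the lower index \<open>L - s - a\<close> into
      \<open>s + a\<close>.\<close>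
    have "(\<Sum>i=0..s. g (s, i)) = q powi (binom2 (int s) + binom2 (int s + a)) * qbinom q L (int s)
        * qbinom q (s + (L - s)) (int (L - s) - a)"
      unfolding g_def prod.case sum_distrib_left[symmetric] q_vandermonde ..
    moreover have "qbinom q (s + (L - s)) (int (L - s) - a) = qbinom q L (int s + a)"
      using qbinom_symmetric[of q L "int s + a"] \<open>s \<in> {0..L}\<close> by (simp add: of_nat_diff algebra_simps)
    ultimately show "(\<Sum>i=0..s. g (s, i)) = q powi (binom2 (int s) + binom2 (int s + a))
        * qbinom q L (int s) * qbinom q L (int s + a)" by simp
  qed
  finally show ?thesis .
qed

section \<open>Evaluation of the sum of products\<close>

lemma one_plus_qbinom_double:
  "(1 + q powi a) * qbinom q (2 * Suc n) (int (Suc n) - a)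
    = (1 + q ^ Suc n) * (qbinom q (2 * n + 1) (int (Suc n) - a) + q powi a * qbinom q (2 * n + 1) (int n - a))"
proof -
  \<comment> \<open>On multiplying by \<open>1 + q powi a\<close>, the copy weighted by
    \<open>q powi a\<close> is expanded with A and the other with B. The cross terms both carry an
    extra \<open>q ^ Suc n\<close>, so \<open>1 + q ^ Suc n\<close> factors out.\<close>
  have A: "qbinom q (2 * Suc n) (int (Suc n) - a) = qbinom q (2 * n + 1) (int n - a)
     + q powi (int (Suc n) - a) * qbinom q (2 * n + 1) (int (Suc n) - a)"
    using qbinom_pascal[of "2 * n + 1" "int (Suc n) - a"] by simp
  have B: "qbinom q (2 * Suc n) (int (Suc n) - a) = qbinom q (2 * n + 1) (int (Suc n) - a)
     + q powi (int (Suc n) + a) * qbinom q (2 * n + 1) (int n - a)"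
    using qbinom_pascal'[of "2 * n + 1" "int (Suc n) - a"] by (simp add: algebra_simps)
  have "q powi a * q powi (int (Suc n) - a) = q ^ Suc n"
    unfolding powi_merge by (simp only: diff_add_cancel add.commute[of a] power_int_of_nat)
  moreover have "q powi (int (Suc n) + a) = q powi a * q ^ Suc n"
    by (simp only: power_int_add[OF disjI1[OF q_nonzero]] power_int_of_nat mult.commute)
  moreover have "(1 + q powi a) * qbinom q (2 * Suc n) (int (Suc n) - a)
     = qbinom q (2 * Suc n) (int (Suc n) - a) + q powi a * qbinom q (2 * Suc n) (int (Suc n) - a)"
    by (simp only: distrib_right mult_1)
  ultimately show ?thesis
    by (subst (asm) (2) A, subst (asm) B) (simp only: algebra_simps, simp only: mult.assoc[symmetric], simp)
qed

lemma sum_qbinom_qbinom: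
  "(\<Sum>s=0..L. q powi (binom2 (int s) + binom2 (int s + a)) * qbinom q L (int s) * qbinom q L (int s + a))
     * (1 + q ^ L) = q powi binom2 a * (1 + q powi a) * qbinom q (2 * L) (int L - a)"
proof (cases L)
  case 0
  \<comment> \<open>Row 0 is treated apart, as the Pascal rule needs \<open>L = Suc n\<close>; both
    sides vanish there unless \<open>a = 0\<close>.\<close>
  have "q powi a = 1" if "qbinom q 0 a \<noteq> 0" using that by (auto simp: qbinom_def split: if_splits)
  then show ?thesis using qbinom_symmetric[of q 0 a] by (auto simp: 0)
next
  case (Suc n)
  have "(\<Sum>s=0..L. q powi (binom2 (int s) + binom2 (int s + a)) * qbinom q L (int s) * qbinom q L (int s + a))
    = (\<Sum>s=0..L. q powi binom2 a * (q powi (int s * (int s + a)) * qbinom q n (int s) * qbinom q L (int s + a))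
      + q powi binom2 a * (q powi (int s * (int s + a) - int s) * qbinom q n (int s - 1) * qbinom q L (int s + a)))"
  proof (intro sum.cong refl)
    fix s
    have "2 * binom2 (int s) = int s * (int s - 1)" by (rule binom2_double)
    then have "binom2 (int s) + binom2 (int s + a) = binom2 a + (int s * (int s + a) - int s)"
      by (simp add: binom2_add algebra_simps)
    then have e: "q powi (binom2 (int s) + binom2 (int s + a)) = q powi binom2 a * q powi (int s * (int s + a) - int s)"
      by (simp add: power_int_add)
    have e': "q powi (int s * (int s + a)) = q powi (int s * (int s + a) - int s) * q powi int s"
      unfolding powi_merge by simp
    have p: "qbinom q L (int s) = qbinom q n (int s - 1) + q powi int s * qbinom q n (int s)"
      unfolding Suc by (rule qbinom_pascal)
    show "q powi (binom2 (int s) + binom2 (int s + a)) * qbinom q L (int s) * qbinom q L (int s + a)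
      = q powi binom2 a * (q powi (int s * (int s + a)) * qbinom q n (int s) * qbinom q L (int s + a))
      + q powi binom2 a * (q powi (int s * (int s + a) - int s) * qbinom q n (int s - 1) * qbinom q L (int s + a))"
      unfolding e e' p by (simp only: algebra_simps)
  qed
  also have "\<dots> = q powi binom2 a * ((\<Sum>s=0..L. q powi (int s * (int s + a)) * qbinom q n (int s) * qbinom q L (int s + a))
      + (\<Sum>s=0..L. q powi (int s * (int s + a) - int s) * qbinom q n (int s - 1) * qbinom q L (int s + a)))"
    by (simp only: sum.distrib sum_distrib_left distrib_left)
  \<comment> \<open>The term \<open>s = L = n + 1\<close> lies outside row \<open>n\<close> and
    vanishes, leaving the q-Vandermonde range.\<close>
  also have "(\<Sum>s=0..L. q powi (int s * (int s + a)) * qbinom q n (int s) * qbinom q L (int s + a))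
      = qbinom q (n + L) (int L - a)"
    by (simp only: q_vandermonde[symmetric] Suc sum.atLeast0_atMost_Suc)
       (simp add: qbinom_eq_0)
  \<comment> \<open>The term \<open>s = 0\<close> vanishes. Shifting \<open>s\<close> by one gives
    the exponent \<open>(s + 1) * (s + a) = a + s * (s + a + 1)\<close>, which is q-Vandermonde with
    shift \<open>a + 1\<close>.\<close>
  also have "(\<Sum>s=0..L. q powi (int s * (int s + a) - int s) * qbinom q n (int s - 1) * qbinom q L (int s + a))
      = (\<Sum>s=0..n. q powi a * (q powi (int s * (int s + (a + 1))) * qbinom q n (int s) * qbinom q L (int s + (a + 1))))"
  proof -
    have "q powi (int (Suc s) * (int (Suc s) + a) - int (Suc s)) = q powi a * q powi (int s * (int s + (a + 1)))" for s
      unfolding powi_merge by (simp add: algebra_simps)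
    then show ?thesis
      unfolding Suc by (subst sum.atLeast0_atMost_Suc_shift) (simp add: qbinom_eq_0 algebra_simps)
  qed
  also have "\<dots> = q powi a * qbinom q (n + L) (int L - (a + 1))"
    unfolding sum_distrib_left[symmetric] q_vandermonde ..
  also have "n + L = 2 * n + 1" by (simp add: Suc)
  also have "int L - (a + 1) = int n - a" by (simp add: Suc)
  finally show ?thesis
    unfolding mult.assoc[of _ "1 + q powi a"] Suc one_plus_qbinom_double
    by (simp only: mult_ac)
qed

section \<open>Gauss inversion\<close>

lemma sum_alternating_qbinom:
  "(\<Sum>i=0..n. (- 1) ^ i * q powi binom2 (int i) * qbinom q n (int i)) = (if n = 0 then 1 else 0)"
proof (cases n)
  case (Suc m)
  \<comment> \<open>The Pascal rule makes each summand a difference of consecutive \<open>h\<close>,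
    since \<open>binom2 (i + 1) = binom2 i + i\<close>. Both end values vanish because their lower
    indices -1 and \<open>m + 1\<close> leave row \<open>m\<close>.\<close>
  define h where "h i = (- 1) ^ i * q powi binom2 (int i) * qbinom q m (int i - 1)" for i :: nat
  have "(\<Sum>i=0..n. (- 1) ^ i * q powi binom2 (int i) * qbinom q n (int i)) = (\<Sum>i=0..n. h i - h (Suc i))"
  proof (intro sum.cong refl)
    fix i
    have "q powi binom2 (int (Suc i)) = q powi binom2 (int i) * q powi int i"
      unfolding powi_merge using binom2_add[of "int i" 1] by (simp add: algebra_simps)
    then show "(- 1) ^ i * q powi binom2 (int i) * qbinom q n (int i) = h i - h (Suc i)"
      unfolding Suc qbinom_pascal h_def by (simp add: algebra_simps)
  qed
  also have "\<dots> = h 0 - h (Suc n)"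
    by (simp add: sum_Suc_diff' sum_telescope atLeast0AtMost)
  also have "\<dots> = 0" by (simp add: h_def Suc qbinom_eq_0)
  finally show ?thesis using Suc by simp
qed simp

lemma qbinom_trinomial_revision:
  assumes "j \<le> k" "k \<le> n"
  shows "qbinom q n (int k) * qbinom q k (int j) = qbinom q n (int j) * qbinom q (n - j) (int (k - j))"
  using assms by (simp add: qbinom_def nat_diff_distrib' flip: of_nat_diff)

text \<open>After inserting \<open>u\<close> and exchanging the sums,
  \<open>qbinom_trinomial_revision\<close> pulls \<open>qbinom q n (int j)\<close> out of the inner
  sum. What remains is the alternating sum of row \<open>n - j\<close>, which is nonzero only for
  \<open>j = n\<close>.\<close>

lemma gauss_inversion:
  fixes u v :: "nat \<Rightarrow> 'a"
  assumes u: "\<And>k. u k = (\<Sum>j=0..k. qbinom q k (int j) * v j)"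
  shows "v n = (\<Sum>k=0..n. (- 1) ^ (n - k) * q powi binom2 (int (n - k)) * qbinom q n (int k) * u k)"
proof -
  define c where "c k = (- 1) ^ (n - k) * q powi binom2 (int (n - k))" for k
  have "(\<Sum>k=0..n. c k * qbinom q n (int k) * u k)
     = (\<Sum>k=0..n. \<Sum>j=0..k. c k * qbinom q n (int k) * qbinom q k (int j) * v j)"
    by (simp add: u sum_distrib_left mult.assoc)
  also have "\<dots> = (\<Sum>j=0..n. \<Sum>k=j..n. c k * qbinom q n (int k) * qbinom q k (int j) * v j)"
    by (subst sum.Sigma, simp, simp, subst sum.Sigma, simp, simp)
       (rule sum.reindex_bij_witness[where i = "\<lambda>(x, y). (y, x)" and j = "\<lambda>(x, y). (y, x)"]; auto)
  also have "\<dots> = (\<Sum>j=0..n. if j = n then v n else 0)"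
  proof (intro sum.cong refl)
    fix j assume "j \<in> {0..n}"
    then have j: "j \<le> n" by simp
    have "(\<Sum>k=j..n. c k * qbinom q n (int k) * qbinom q k (int j) * v j)
        = (\<Sum>k=j..n. qbinom q n (int j) * v j * (c k * qbinom q (n - j) (int (k - j))))"
    proof (intro sum.cong refl)
      fix k assume "k \<in> {j..n}"
      then have "qbinom q n (int k) * qbinom q k (int j) = qbinom q n (int j) * qbinom q (n - j) (int (k - j))"
        by (intro qbinom_trinomial_revision) auto
      then show "c k * qbinom q n (int k) * qbinom q k (int j) * v j
          = qbinom q n (int j) * v j * (c k * qbinom q (n - j) (int (k - j)))"
        by (metis (no_types, opaque_lifting) mult.assoc mult.left_commute mult.commute)
    qed
    also have "\<dots> = qbinom q n (int j) * v j * (\<Sum>k=j..n. c k * qbinom q (n - j) (int (k - j)))"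
      by (simp add: sum_distrib_left)
    also have "(\<Sum>k=j..n. c k * qbinom q (n - j) (int (k - j)))
        = (\<Sum>i=0..n - j. (- 1) ^ i * q powi binom2 (int i) * qbinom q (n - j) (int i))"
    \<comment> \<open>The substitution \<open>i = n - k\<close> reverses the range; the symmetry of
      row \<open>n - j\<close> restores the lower index.\<close>
    proof (rule sum.reindex_bij_witness[where i = "\<lambda>i. n - i" and j = "\<lambda>k. n - k"])
      fix k assume k: "k \<in> {j..n}"
      then have "int (k - j) = int (n - j) - int (n - k)" by auto
      then have "qbinom q (n - j) (int (k - j)) = qbinom q (n - j) (int (n - k))"
        by (simp only: qbinom_symmetric)
      then show "(- 1) ^ (n - k) * q powi binom2 (int (n - k)) * qbinom q (n - j) (int (n - k))
          = c k * qbinom q (n - j) (int (k - j))" by (simp add: c_def)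
    qed (use j in auto)
    also have "\<dots> = (if n - j = 0 then 1 else 0)" by (rule sum_alternating_qbinom)
    finally show "(\<Sum>k=j..n. c k * qbinom q n (int k) * qbinom q k (int j) * v j) = (if j = n then v n else 0)"
      using j by auto
  qed
  finally show ?thesis by (simp add: c_def)
qed

text \<open>The second identity with its denominators cleared: \<open>1 + q ^ L\<close> is not known
  to be invertible for \<open>L = 0\<close>.\<close>

lemma sum_qtrinom_eq_qbinom_double:
  "(\<Sum>k=0..L. qbinom q L (int k) * (q powi binom2 (int k) * qtrinom q 1 k a)) * (1 + q ^ L)
     = q powi binom2 a * (1 + q powi a) * qbinom q (2 * L) (int L - a)"
  unfolding mult.assoc[symmetric] sum_qtrinom_eq sum_qbinom_qbinom ..

end

section \<open>Specialization to rational functions over the rationals\<close>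

lemma qvar_power: "qvar ^ n = Fract (monom 1 n) 1"
  by (induction n) (simp_all add: qvar_def One_fract_def monom_Suc)

interpretation qvar: non_root_of_unity qvar
proof
  show "qvar \<noteq> 0" by (simp add: qvar_def Zero_fract_def eq_fract)
  show "qvar ^ n \<noteq> 1" if "0 < n" for n
    using that by (simp add: qvar_power One_fract_def eq_fract monom_eq_1_iff)
qed

text \<open>For \<open>k = 0\<close> this is \<open>2 \<noteq> 0\<close>, which holds in
  characteristic 0.\<close>

lemma one_plus_qvar_powi_nonzero: "1 + qvar powi k \<noteq> 0"
  by (cases "k = 0") (simp_all add: qvar.one_plus_power_int_nonzero)

lemma one_plus_qvar_power_nonzero: "1 + qvar ^ k \<noteq> 0"
  using one_plus_qvar_powi_nonzero[of "int k"] by simp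

theorem lemma2p2:
  fixes L :: nat and a :: int
  shows "qtrinom qvar 1 L a
           = (\<Sum>k=0..L. Dcoef qvar L k a * qbinom qvar (2 * k) (int k - a))
       \<and> qbinom qvar (2 * L) (int L - a)
           = (\<Sum>k=0..L. Dcoef' qvar L k a * qtrinom qvar 1 k a)"
proof
  define u where "u k = qvar powi binom2 a * ((1 + qvar powi a) / (1 + qvar ^ k)) * qbinom qvar (2 * k) (int k - a)" for k
  define v where "v k = qvar powi binom2 (int k) * qtrinom qvar 1 k a" for k
  have u: "u k = (\<Sum>j=0..k. qbinom qvar k (int j) * v j)" for k
    using qvar.sum_qtrinom_eq_qbinom_double[of k a] one_plus_qvar_power_nonzero[of k]
    by (simp add: u_def v_def field_simps)
  \<comment> \<open>Undoing the weight in \<open>v L\<close> supplies the term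
    \<open>- binom2 L\<close> in the exponent of \<open>Dcoef\<close>; the inversion kernel and
    \<open>u k\<close> supply the rest.\<close>
  have "qtrinom qvar 1 L a = qvar powi (- binom2 (int L)) * v L"
    by (simp add: v_def power_int_minus)
  also have "\<dots> = (\<Sum>k=0..L. qvar powi (- binom2 (int L)) *
     ((- 1) ^ (L - k) * qvar powi binom2 (int (L - k)) * qbinom qvar L (int k) * u k))"
    by (subst qvar.gauss_inversion[OF u]) (simp add: sum_distrib_left)
  also have "\<dots> = (\<Sum>k=0..L. Dcoef qvar L k a * qbinom qvar (2 * k) (int k - a))"
  proof (intro sum.cong refl)
    fix k assume "k \<in> {0..L}"
    then have e: "int L - int k = int (L - k)" by simp
    show "qvar powi (- binom2 (int L)) *
     ((- 1) ^ (L - k) * qvar powi binom2 (int (L - k)) * qbinom qvar L (int k) * u k)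
      = Dcoef qvar L k a * qbinom qvar (2 * k) (int k - a)"
      unfolding Dcoef_def u_def e power_int_of_nat
      by (simp only: diff_conv_add_uminus power_int_add[OF disjI1[OF qvar.q_nonzero]] mult_ac)
  qed
  finally show "qtrinom qvar 1 L a = (\<Sum>k=0..L. Dcoef qvar L k a * qbinom qvar (2 * k) (int k - a))" .
  \<comment> \<open>The prefactor is free of \<open>k\<close> and is the reciprocal of the one in
    \<open>u L\<close>, so only the q-binomial remains.\<close>
  have "(\<Sum>k=0..L. Dcoef' qvar L k a * qtrinom qvar 1 k a)
      = qvar powi (- binom2 a) * ((1 + qvar ^ L) / (1 + qvar powi a)) * u L"
    unfolding u sum_distrib_left Dcoef'_def v_def
    by (intro sum.cong refl)
      (simp only: diff_conv_add_uminus power_int_add[OF disjI1[OF qvar.q_nonzero]] mult_ac)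
  also have "\<dots> = qbinom qvar (2 * L) (int L - a)"
    using one_plus_qvar_power_nonzero[of L] one_plus_qvar_powi_nonzero[of a]
    by (simp add: u_def power_int_minus)
  finally show "qbinom qvar (2 * L) (int L - a) = (\<Sum>k=0..L. Dcoef' qvar L k a * qtrinom qvar 1 k a)" ..
qed

end
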